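(* Let $k$ be a positive integer that is not a power of $2$. Let $T$ be the array with $c_{0,0}=1$ and all other entries $0$. Define sets of arrays $\mathrm{Sol}(j)$, $j\in\mathbb{Z}$, by $\mathrm{Sol}(j)=\emptyset$ for $j\leq 0$, $\mathrm{Sol}(1)=\{T\}$, and, for $j\geq2$, recursively as follows, where $P_m(X)$ denotes the set of all arrays obtained from some array in $X$ by a priority expansion under Move $m$: - if $k\equiv0\pmod 4$: $\mathrm{Sol}(j)=P_1(\mathrm{Sol}(j-1))\cup P_2(\mathrm{Sol}(j-(k/4-1)))$; - if $k\equiv1\pmod 4$: $\mathrm{Sol}(j)=P_1(\mathrm{Sol}(j-1))\cup P_2(\mathrm{Sol}(j-(k-1)))\cup P_3(\mathrm{Sol}(j-(k-1)/4))\cup P_4(\mathrm{Sol}(j-(k-1)/2))$; - if $k\equiv2\pmod 4$: $\mathrm{Sol}(j)=P_1(\mathrm{Sol}(j-1))\cup P_2(\mathrm{Sol}(j-(k/2-1)))\cup P_4(\mathrm{Sol}(j-(k-2)/4))$; - if $k\equiv3\pmod 4$: $\mathrm{Sol}(j)=P_1(\mathrm{Sol}(j-1))\cup P_2(\mathrm{Sol}(j-(k-1)))\cup P_3(\mathrm{Sol}(j-(3k-5)/4))\cup P_4(\mathrm{Sol}(j-(k-1)/2))\cup P_5(\mathrm{Sol}(j-(k+1)/4))$. Then for every positive integer $n$, $\mathrm{Sol}(n)$ is exactly the set of arrays corresponding to solutions of $\sum_{i=1}^n 1/x_i=1$, $x_1\leq\dotsb\leq x_n$, with every $x_i\in S(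k)$.
   Context: For a positive integer $k$ that is not a power of $2$ (so $k\geq3$), let $S(k)=\{2^ak^b\mid a\in\{0,1,2\},\ b\in\mathbb{Z}_{\geq0}\}$; each element is uniquely of the form $2^ak^b$. An array is a finitely supported family of nonnegative integers $c_{a,b}$, $a\in\{0,1,2\}$ (column index), $b\in\mathbb{Z}_{\geq0}$ (row index); row $b$ is $(c_{0,b},c_{1,b},c_{2,b})$. The array corresponding to a solution of $\sum_{i=1}^n 1/x_i=1$, $x_1\leq\dotsb\leq x_n$, with every $x_i\in S(k)$, has $c_{a,b}=$ the number of indices $i$ with $x_i=2^ak^b$; it determines the solution, and the number of terms $n$ is the sum of its entries. Moves. Each move can be applied forward (a reduction) or in reverse (an expansion), provided that all entries remain nonnegative. Move 1 (forward): for some row $b$ and some $a\in\{0,1\}$ with $c_{a+1,b}\geq2$, decrease $c_{a+1,b}$ by $2$ and increase $c_{a,b}$ by $1$. Moves 2--5 (forward) are given by a rule $u\to v$ with $u,v\in\mathbb{Z}_{\geq0}^3$: for some $b\geq0$ such that row $b+1$ is entrywise $\geq u$, subtract $u$ from row $b+1$ and add $v$ to row $b$. The rules are: Move 2: $(k/4,0,0)\to(0,0,1)$ if $k\equiv0\pmod4$; $(k,0,0)\to(1,0,0)$ if $k$ is odd; $(k/2,0,0)\to(0,1,0)$ if $k\equiv2\pmod4$. Move 3 (only for odd $k$): $((k-1)/4,0,1)\to(0,0,1)$ if $k\equiv1\pmod4$; $((3k-1)/4,0,1)\to(0,1,1)$ if $k\equiv3\pmod4$. Move 4 (only for $k\not\equiv0\pmod4$):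 $((k-1)/2,1,0)\to(0,1,0)$ if $k$ is odd; $((k-2)/4,1,0)\to(0,0,1)$ if $k\equiv2\pmod4$. Move 5 (only for odd $k$): $((3k-3)/4,1,1)\to(0,1,1)$ if $k\equiv1\pmod4$; $((k-3)/4,1,1)\to(0,0,1)$ if $k\equiv3\pmod4$. Priority reductions and expansions. Let $A$ be an array corresponding to a solution with every $x_i\in S(k)$ and let $\beta$ be the index of its top nonzero row (the largest $b$ such that row $b$ is nonzero). The priority reduction of $A$ is the first of the following that can be applied: (1) if $c_{2,\beta}\geq2$, Move 1 reducing the entry $c_{2,\beta}$; (2) if $c_{1,\beta}\geq2$, Move 1 reducing the entry $c_{1,\beta}$; (3), (4), (5), (6): respectively Move 2, Move 3, Move 4, Move 5 (where defined) in the forward direction, with row $\beta$ as the upper row $b+1$. An expansion taking an array $B$ to an array $A$ is a priority expansion if its inverse is the priority reduction of $A$. *)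

theory Defs
  imports Complex_Main
begin

definition S_set :: "nat \<Rightarrow> nat set" where
  "S_set k = {2 ^ a * k ^ b | a b. a \<le> 2}"

text \<open>A solution with \<open>n\<close> terms is the sorted list \<open>[x\<^sub>1, \<dots>, x\<^sub>n]\<close>.\<close>

definition solutions :: "nat \<Rightarrow> nat \<Rightarrow> nat list set" where
  "solutions k n =
     {xs. length xs = n \<and> sorted xs \<and> set xs \<subseteq> S_set k \<and> (\<Sum>x\<leftarrow>xs. 1 / rat_of_nat x) = 1}"

text \<open>An array is written \<open>c a b\<close> with column index \<open>a\<close> first and row index \<open>b\<close> second;
  the columns \<open>a > 2\<close> are padding and kept at \<open>0\<close>.\<close>

type_synonym arr = "nat \<Rightarrow> nat \<Rightarrow> nat"

definition arrays :: "arr set" where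
  "arrays = {c. finite {(a, b). c a b \<noteq> 0} \<and> (\<forall>a>2. \<forall>b. c a b = 0)}"

definition array_of :: "nat \<Rightarrow> nat list \<Rightarrow> arr" where
  "array_of k xs = (\<lambda>a b. if a \<le> 2 then card {i. i < length xs \<and> xs ! i = 2 ^ a * k ^ b} else 0)"

definition solution_arrays :: "nat \<Rightarrow> nat \<Rightarrow> arr set" where
  "solution_arrays k n = array_of k ` solutions k n"

text \<open>All moves are given in the forward direction (as reductions), with result \<open>None\<close>
  if the move cannot be applied.\<close>

definition move1 :: "nat \<Rightarrow> nat \<Rightarrow> arr \<Rightarrow> arr option" where
  "move1 a b c =
     (if c (a + 1) b \<ge> 2
      then Some (\<lambda>a' b'. if a' = a + 1 \<and> b' = b then c a' b' - 2
                         else if a' = a \<and> b' = b then c a' b' + 1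
                         else c a' b')
      else None)"

definition row :: "nat \<Rightarrow> nat \<Rightarrow> nat \<Rightarrow> (nat \<Rightarrow> nat)" where
  "row x y z = (\<lambda>_. 0)(0 := x, 1 := y, 2 := z)"

type_synonym rule = "(nat \<Rightarrow> nat) \<times> (nat \<Rightarrow> nat)"

definition rule2 :: "nat \<Rightarrow> rule option" where
  "rule2 k =
     (if k mod 4 = 0 then Some (row (k div 4) 0 0, row 0 0 1)
      else if odd k then Some (row k 0 0, row 1 0 0)
      else Some (row (k div 2) 0 0, row 0 1 0))"

definition rule3 :: "nat \<Rightarrow> rule option" where
  "rule3 k =
     (if k mod 4 = 1 then Some (row ((k - 1) div 4) 0 1, row 0 0 1)
      else if k mod 4 = 3 then Some (row ((3 * k - 1) div 4) 0 1, row 0 1 1)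
      else None)"

definition rule4 :: "nat \<Rightarrow> rule option" where
  "rule4 k =
     (if odd k then Some (row ((k - 1) div 2) 1 0, row 0 1 0)
      else if k mod 4 = 2 then Some (row ((k - 2) div 4) 1 0, row 0 0 1)
      else None)"

definition rule5 :: "nat \<Rightarrow> rule option" where
  "rule5 k =
     (if k mod 4 = 1 then Some (row ((3 * k - 3) div 4) 1 1, row 0 1 1)
      else if k mod 4 = 3 then Some (row ((k - 3) div 4) 1 1, row 0 0 1)
      else None)"

text \<open>The argument \<open>\<beta>\<close> is the index of the upper of the two rows involved, so nothing can be
  applied if \<open>\<beta> = 0\<close>.\<close>

definition apply_rule :: "rule option \<Rightarrow> nat \<Rightarrow> arr \<Rightarrow> arr option" where
  "apply_rule r \<beta> c =
     (case (r, \<beta>) of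
        (Some (u, v), Suc b) \<Rightarrow>
          (if \<forall>a. u a \<le> c a (b + 1)
           then Some (\<lambda>a b'. if b' = b + 1 then c a b' - u a
                             else if b' = b then c a b' + v a
                             else c a b')
           else None)
      | _ \<Rightarrow> None)"

definition top_row :: "arr \<Rightarrow> nat" where
  "top_row c = Max {b. \<exists>a. c a b \<noteq> 0}"

text \<open>The candidates for the priority reduction, in order of priority, each with the number of
  the move it belongs to.\<close>

definition candidates :: "nat \<Rightarrow> arr \<Rightarrow> (nat \<times> arr option) list" where
  "candidates k c =
     (let \<beta> = top_row c in
       [(1, move1 1 \<beta> c),
        (1, move1 0 \<beta> c),
        (2, apply_rule (rule2 k) \<beta> c),
        (3, apply_rule (rule3 k) \<beta> c),
        (4, apply_rule (rule4 k) \<beta> c),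
        (5, apply_rule (rule5 k) \<beta> c)])"

text \<open>The priority reduction of \<open>A\<close> is an instance of Move \<open>m\<close> and takes \<open>A\<close> to \<open>B\<close>.\<close>

definition priority_reduction :: "nat \<Rightarrow> nat \<Rightarrow> arr \<Rightarrow> arr \<Rightarrow> bool" where
  "priority_reduction k m A B \<longleftrightarrow>
     find (\<lambda>(_, r). r \<noteq> None) (candidates k A) = Some (m, Some B)"

definition prio_expansions :: "nat \<Rightarrow> nat \<Rightarrow> arr set \<Rightarrow> arr set" where
  "prio_expansions k m X = {A \<in> arrays. \<exists>B\<in>X. priority_reduction k m A B}"

definition start_array :: arr where
  "start_array = (\<lambda>a b. if a = 0 \<and> b = 0 then 1 else 0)"

text \<open>The recursion is well-founded only because \<open>k\<close> is positive and not a power of two (for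
  \<open>k = 4\<close>, say, \<open>Sol k j\<close> would refer to itself). The first condition below excludes the
  other values of \<open>k\<close>.\<close>

function Sol :: "nat \<Rightarrow> int \<Rightarrow> arr set" where
  "Sol k j =
     (if k = 0 \<or> (\<exists>i. k = 2 ^ i) then {}
      else if j \<le> 0 then {}
      else if j = 1 then {start_array}
      else if k mod 4 = 0 then
        prio_expansions k 1 (Sol k (j - 1)) \<union>
        prio_expansions k 2 (Sol k (j - (int k div 4 - 1)))
      else if k mod 4 = 1 then
        prio_expansions k 1 (Sol k (j - 1)) \<union>
        prio_expansions k 2 (Sol k (j - (int k - 1))) \<union>
        prio_expansions k 3 (Sol k (j - (int k - 1) div 4)) \<union>
        prio_expansions k 4 (Sol k (j - (int k - 1) div 2))
      else if k mod 4 = 2 then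
        prio_expansions k 1 (Sol k (j - 1)) \<union>
        prio_expansions k 2 (Sol k (j - (int k div 2 - 1))) \<union>
        prio_expansions k 4 (Sol k (j - (int k - 2) div 4))
      else
        prio_expansions k 1 (Sol k (j - 1)) \<union>
        prio_expansions k 2 (Sol k (j - (int k - 1))) \<union>
        prio_expansions k 3 (Sol k (j - (3 * int k - 5) div 4)) \<union>
        prio_expansions k 4 (Sol k (j - (int k - 1) div 2)) \<union>
        prio_expansions k 5 (Sol k (j - (int k + 1) div 4)))"
  by pat_completeness auto
termination
proof -
  have *: "k \<ge> 3 \<and>
      (k mod 4 = 0 \<longrightarrow> int k div 4 - 1 > 0) \<and>
      (k mod 4 = 1 \<longrightarrow> (int k - 1) div 4 > 0) \<and>
      (k mod 4 = 2 \<longrightarrow> (int k - 2) div 4 > 0) \<and>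
      (int k - 1) div 2 > 0 \<and>
      (k mod 4 = 2 \<longrightarrow> int k div 2 - 1 > 0) \<and>
      (3 * int k - 5) div 4 > 0 \<and> (int k + 1) div 4 > 0"
    if "\<not> (k = 0 \<or> (\<exists>i. k = 2 ^ i))" for k :: nat
  proof -
    have "k \<noteq> 0" "k \<noteq> 2 ^ 0" "k \<noteq> 2 ^ 1" "k \<noteq> 2 ^ 2" using that by metis+
    then have "k \<noteq> 0" "k \<noteq> 1" "k \<noteq> 2" "k \<noteq> 4" by simp_all
    then show ?thesis by (intro conjI impI; presburger)
  qed
  have descent: "((k, j - d), (k, j)) \<in> measure (\<lambda>(k, j). nat j)"
    if "\<not> j \<le> 0" "d > 0" for k :: nat and j d :: int
    using that by simp
  show ?thesis
    by (relation "measure (\<lambda>(k, j). nat j)") (simp, (rule descent, assumption, drule *, simp)+)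
qed

declare Sol.simps [simp del]

end

theory Submission
  imports Defs "HOL-Computational_Algebra.Primes"
begin

text \<open>Every move preserves the reciprocal sum and lowers the number of terms by a constant. So it
  is enough that each solution array other than the start array has a priority reduction. If
  Move 1 cannot be applied to the top row \<open>(x, y, z)\<close>, then \<open>y, z \<le> 1\<close>. If this row is row 0, the
  reciprocal sum forces \<open>(1, 0, 0)\<close>. Otherwise multiplying the sum by \<open>4 k\<^sup>\<beta>\<close> shows that \<open>k\<close> divides
  \<open>4 x + 2 y + z\<close>, and for each residue of \<open>k\<close> modulo 4 and each \<open>y, z\<close> the smallest possible
  multiple of \<open>k\<close> is at least what one of Moves 2--5 consumes.\<close>

section \<open>Bounded support and weighted sums of arrays\<close>

text \<open>A fixed row bound turns every sum over an array into a sum over one finite rectangle. It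
  stays a parameter so that an array can share it with its reduction.\<close>

definition supported :: "nat \<Rightarrow> arr \<Rightarrow> bool" where
  "supported N c \<longleftrightarrow> (\<forall>a b. c a b \<noteq> 0 \<longrightarrow> a \<le> 2 \<and> b \<le> N)"

text \<open>With a general semiring and a free weight \<open>f\<close>, the number of terms, the
  rational reciprocal sum and its integer multiple are all instances, and additivity is proved
  once.\<close>

definition mass :: "(nat \<Rightarrow> nat \<Rightarrow> 'a::comm_semiring_1) \<Rightarrow> nat \<Rightarrow> arr \<Rightarrow> 'a" where
  "mass f N c = (\<Sum>(a, b)\<in>{..2} \<times> {..N}. f a b * of_nat (c a b))"

text \<open>This is the reciprocal sum with denominators cleared by \<open>4 * k ^ N\<close>, a
  natural number to which divisibility by \<open>k\<close> applies. On the rectangle of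
  \<open>mass\<close> neither \<open>2 - a\<close> nor \<open>N - b\<close> is truncated.\<close>

definition scaled_weight :: "nat \<Rightarrow> nat \<Rightarrow> arr \<Rightarrow> nat" where
  "scaled_weight k N = mass (\<lambda>a b. 2 ^ (2 - a) * k ^ (N - b)) N"

definition array_size :: "nat \<Rightarrow> arr \<Rightarrow> nat" where
  "array_size = mass (\<lambda>_ _. 1)"

lemma arrays_iff_supported: "c \<in> arrays \<longleftrightarrow> (\<exists>N. supported N c)"
proof
  assume c: "c \<in> arrays"
  then have "finite (snd ` {(a, b). c a b \<noteq> 0})" by (simp add: arrays_def)
  then obtain N where "\<forall>b \<in> snd ` {(a, b). c a b \<noteq> 0}. b \<le> N"
    by (meson finite_nat_set_iff_bounded_le)
  then have "b \<le> N" if "c a b \<noteq> 0" for a b using that by force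
  moreover have "a \<le> 2" if "c a b \<noteq> 0" for a b
    using c that unfolding arrays_def by (metis (mono_tags, lifting) mem_Collect_eq not_le)
  ultimately have "supported N c" by (simp add: supported_def)
  then show "\<exists>N. supported N c" ..
next
  assume "\<exists>N. supported N c"
  then obtain N where N: "supported N c" ..
  have "{(a, b). c a b \<noteq> 0} \<subseteq> {..2} \<times> {..N}" using N by (auto simp: supported_def)
  then have "finite {(a, b). c a b \<noteq> 0}" by (rule finite_subset) simp
  moreover have "c a b = 0" if "a > 2" for a b
    using N that unfolding supported_def by (meson not_le)
  ultimately show "c \<in> arrays" by (simp add: arrays_def)
qed

lemma supported_mono: "supported N c \<Longrightarrow> N \<le> N' \<Longrightarrow> supported N' c"
  unfolding supported_def by (meson le_trans)

section \<open>Correspondence between arrays and solutions\<close>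

text \<open>If \<open>b > b'\<close>, cancelling \<open>k ^ b'\<close> makes \<open>k\<close> a
  divisor of a power of 2, hence itself a power of 2. Used in both directions, this gives uniqueness
  of the form \<open>2 ^ a * k ^ b\<close>.\<close>

lemma denominator_eq_imp_exponent_le:
  fixes k :: nat
  assumes "\<not> (\<exists>i. k = 2 ^ i)" and "2 ^ a * k ^ b = 2 ^ a' * k ^ b'" and "k > 0"
  shows "b \<le> b'"
proof (rule ccontr)
  assume "\<not> b \<le> b'"
  then obtain d where b: "b = b' + Suc d" by (metis add_Suc_right less_imp_Suc_add not_le)
  then have "k ^ b' * (2 ^ a * k ^ Suc d) = k ^ b' * 2 ^ a'"
    using assms(2) by (simp add: power_add ac_simps)
  then have "2 ^ a * k ^ Suc d = 2 ^ a'" using \<open>k > 0\<close> by simp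
  then have "k dvd 2 ^ a'" by (metis dvd_mult dvd_triv_left power_Suc)
  then show False using assms(1) divides_primepow_nat[OF two_is_prime_nat] by blast
qed

lemma inj_on_denominator:
  fixes k :: nat
  assumes "\<not> (\<exists>i. k = 2 ^ i)" and "k > 0"
  shows "inj_on (\<lambda>(a, b). 2 ^ a * k ^ b) X"
proof (rule inj_onI; clarify)
  fix a b a' b' assume eq: "2 ^ a * k ^ b = 2 ^ a' * k ^ b'"
  then have "b = b'"
    using denominator_eq_imp_exponent_le[OF assms(1)] assms(2) by (metis order_antisym)
  then show "a = a' \<and> b = b'" using eq assms(2) by simp
qed

lemma array_of_eq_count:
  "array_of k xs a b = (if a \<le> 2 then count_list xs (2 ^ a * k ^ b) else 0)"
  by (simp add: array_of_def count_list_eq_length_filter length_filter_conv_card eq_commute)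

lemma array_of_in_arrays:
  assumes "\<not> (\<exists>i. k = 2 ^ i)" and "k > 0"
  shows "array_of k xs \<in> arrays"
proof -
  let ?\<phi> = "\<lambda>(a, b). 2 ^ a * k ^ b"
  let ?X = "{(a, b). array_of k xs a b \<noteq> 0}"
  have "?\<phi> ` ?X \<subseteq> set xs"
    by (auto simp: array_of_eq_count count_list_0_iff simp del: neq0_conv split: if_splits)
  then have "finite ?X"
    using finite_subset finite_imageD[OF _ inj_on_denominator[OF assms]] by blast
  then show ?thesis by (simp add: arrays_def array_of_eq_count)
qed

lemma sum_list_map_eq_sum_count_list:
  fixes g :: "'b \<Rightarrow> 'a::comm_semiring_1"
  assumes "finite X" "set xs \<subseteq> X"
  shows "(\<Sum>x\<leftarrow>xs. g x) = (\<Sum>x\<in>X. g x * of_nat (count_list xs x))"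
  using assms(2)
proof (induction xs)
  case (Cons y ys)
  have "(\<Sum>x\<in>X. g x * of_nat (count_list (y # ys) x)) =
      (\<Sum>x\<in>X. (if x = y then g x else 0) + g x * of_nat (count_list ys x))"
    by (intro sum.cong) (auto simp: algebra_simps)
  also have "\<dots> = g y + (\<Sum>x\<leftarrow>ys. g x)"
    using Cons \<open>finite X\<close> by (simp add: sum.distrib)
  finally show ?case by simp
qed simp

text \<open>Each term of the list has exactly one position in the array, so the sum regroups by
  positions. It is needed for the length (\<open>g\<close> constantly 1) and for the reciprocal
  sum.\<close>

lemma sum_list_eq_mass:
  fixes g :: "nat \<Rightarrow> 'a::comm_semiring_1"
  assumes k: "\<not> (\<exists>i. k = 2 ^ i)" "k > 0"
    and xs: "set xs \<subseteq> S_set k" and N: "supported N (array_of k xs)"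
  shows "(\<Sum>x\<leftarrow>xs. g x) = mass (\<lambda>a b. g (2 ^ a * k ^ b)) N (array_of k xs)"
proof -
  let ?\<phi> = "\<lambda>(a, b). 2 ^ a * k ^ b"
  let ?D = "{..2} \<times> {..N}"
  have sub: "set xs \<subseteq> ?\<phi> ` ?D"
  proof
    fix x assume x: "x \<in> set xs"
    then obtain a b where ab: "x = 2 ^ a * k ^ b" "a \<le> 2" using xs by (auto simp: S_set_def)
    then have "array_of k xs a b \<noteq> 0" using x by (simp add: array_of_eq_count count_list_0_iff)
    then have "b \<le> N" using N by (simp add: supported_def)
    then show "x \<in> ?\<phi> ` ?D" using ab by force
  qed
  have "(\<Sum>x\<leftarrow>xs. g x) = (\<Sum>x\<in>?\<phi> ` ?D. g x * of_nat (count_list xs x))"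
    using sub by (intro sum_list_map_eq_sum_count_list) auto
  also have "\<dots> = (\<Sum>p\<in>?D. g (?\<phi> p) * of_nat (count_list xs (?\<phi> p)))"
    by (rule sum.reindex[OF inj_on_denominator[OF k], unfolded comp_def])
  also have "\<dots> = mass (\<lambda>a b. g (2 ^ a * k ^ b)) N (array_of k xs)"
    unfolding mass_def by (intro sum.cong) (auto simp: array_of_eq_count)
  finally show ?thesis .
qed

lemma scaled_weight_eq_reciprocal_sum:
  assumes "k > 0"
  shows "rat_of_nat (scaled_weight k N c) =
    4 * of_nat k ^ N * mass (\<lambda>a b. 1 / rat_of_nat (2 ^ a * k ^ b)) N c"
proof -
  have "rat_of_nat (2 ^ (2 - a) * k ^ (N - b) * c a b) =
      4 * of_nat k ^ N * (1 / rat_of_nat (2 ^ a * k ^ b) * rat_of_nat (c a b))"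
    if "a \<le> 2" "b \<le> N" for a b
  proof -
    have two: "(4::rat) = 2 ^ (2 - a) * 2 ^ a" using \<open>a \<le> 2\<close> by (simp flip: power_add)
    have k: "rat_of_nat k ^ N = of_nat k ^ (N - b) * of_nat k ^ b"
      using \<open>b \<le> N\<close> by (simp flip: power_add)
    \<comment> \<open>Pure cancellation, used with \<open>x = 2 ^ a\<close>,
      \<open>y = k ^ b\<close> and with \<open>p\<close>, \<open>q\<close> the complementary powers
      from \<open>two\<close> and \<open>k\<close>.\<close>
    have "p * q * r = (p * x) * (q * y) * (1 / (x * y) * r)" if "x \<noteq> 0" "y \<noteq> 0"
      for p q r x y :: rat using that by simp
    from this[of "2 ^ a" "of_nat k ^ b" "2 ^ (2 - a)" "of_nat k ^ (N - b)" "of_nat (c a b)"] assms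
    show ?thesis unfolding two k by simp
  qed
  then show ?thesis
    unfolding scaled_weight_def mass_def sum_distrib_left of_nat_sum
    by (intro sum.cong) auto
qed

text \<open>Take \<open>c a b\<close> copies of each denominator and sort. Injectivity of the
  denominators ensures that no two positions contribute to the same count.\<close>

lemma array_of_surj:
  assumes k: "\<not> (\<exists>i. k = 2 ^ i)" "k > 0" and N: "supported N c"
  obtains xs where "sorted xs" "set xs \<subseteq> S_set k" "array_of k xs = c"
proof
  let ?D = "{..2} \<times> {..N}"
  define M where "M = (\<Sum>(a, b)\<in>?D. replicate_mset (c a b) (2 ^ a * k ^ b))"
  define xs where "xs = sorted_list_of_multiset M"
  have count: "count M (2 ^ a * k ^ b) = c a b" if "a \<le> 2" for a b
  proof -
    have "count M (2 ^ a * k ^ b) = (\<Sum>p\<in>?D. if p = (a, b) then c a b else 0)"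
      unfolding M_def count_sum using inj_on_denominator[OF k, of UNIV, THEN injD, of _ "(a, b)"]
      by (intro sum.cong) (auto split: prod.splits)
    also have "\<dots> = (if (a, b) \<in> ?D then c a b else 0)" by (simp only: sum.delta finite_SigmaI finite_atMost)
    also have "\<dots> = c a b" using N that by (auto simp: supported_def)
    finally show ?thesis .
  qed
  have cl: "count_list xs x = count M x" for x
    unfolding xs_def by (metis count_mset mset_sorted_list_of_multiset)
  show "sorted xs" by (simp add: xs_def)
  have "set_mset M \<subseteq> S_set k"
    unfolding M_def by (auto simp: set_mset_sum S_set_def split: if_splits) blast
  then show "set xs \<subseteq> S_set k" by (simp add: xs_def)
  show "array_of k xs = c"
    using N by (auto simp: fun_eq_iff array_of_eq_count cl count supported_def)
qed

text \<open>Replaces lists by two numbers: afterwards a move only has to be checked for its effect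
  on \<open>scaled_weight\<close> and \<open>array_size\<close>.\<close>

lemma solution_arrays_iff:
  assumes k: "\<not> (\<exists>i. k = 2 ^ i)" "k > 0" and N: "supported N c"
  shows "c \<in> solution_arrays k n \<longleftrightarrow> scaled_weight k N c = 4 * k ^ N \<and> array_size N c = n"
proof -
  have length: "length xs = array_size N c"
    and sum: "(\<Sum>x\<leftarrow>xs. 1 / rat_of_nat x) = 1 \<longleftrightarrow> scaled_weight k N c = 4 * k ^ N"
    if xs: "set xs \<subseteq> S_set k" "array_of k xs = c" for xs
  proof -
    have N': "supported N (array_of k xs)" using N xs(2) by simp
    show "length xs = array_size N c"
      using sum_list_eq_mass[OF k xs(1) N', of "\<lambda>_. 1::nat"]
      unfolding array_size_def xs(2) by (simp add: sum_list_triv)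
    have "rat_of_nat (scaled_weight k N c) = 4 * of_nat k ^ N * (\<Sum>x\<leftarrow>xs. 1 / rat_of_nat x)"
      unfolding scaled_weight_eq_reciprocal_sum[OF k(2)] sum_list_eq_mass[OF k xs(1) N'] xs(2) ..
    \<comment> \<open>The nonzero factor cancels, and the remaining rational equation is between
      images of naturals, so it descends to \<open>nat\<close>.\<close>
    moreover have "(4 * rat_of_nat k ^ N) * w = 4 * rat_of_nat k ^ N \<longleftrightarrow> w = 1" for w
      using k(2) by simp
    ultimately have "(\<Sum>x\<leftarrow>xs. 1 / rat_of_nat x) = 1 \<longleftrightarrow>
        rat_of_nat (scaled_weight k N c) = rat_of_nat (4 * k ^ N)"
      by simp
    then show "(\<Sum>x\<leftarrow>xs. 1 / rat_of_nat x) = 1 \<longleftrightarrow> scaled_weight k N c = 4 * k ^ N"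
      unfolding of_nat_eq_iff .
  qed
  obtain ys where ys: "sorted ys" "set ys \<subseteq> S_set k" "array_of k ys = c"
    using array_of_surj[OF k N] .
  show ?thesis
  proof
    assume "c \<in> solution_arrays k n"
    then obtain xs where "xs \<in> solutions k n" "array_of k xs = c"
      unfolding solution_arrays_def by blast
    then show "scaled_weight k N c = 4 * k ^ N \<and> array_size N c = n"
      using length[of xs] sum[of xs] unfolding solutions_def by simp
  next
    assume "scaled_weight k N c = 4 * k ^ N \<and> array_size N c = n"
    then have "ys \<in> solutions k n"
      unfolding solutions_def using ys length[OF ys(2,3)] sum[OF ys(2,3)] by simp
    then show "c \<in> solution_arrays k n" unfolding solution_arrays_def using ys(3) by blast
  qed
qed

lemma solution_arrays_subset_arrays:
  assumes "\<not> (\<exists>i. k = 2 ^ i)" "k > 0"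
  shows "solution_arrays k n \<subseteq> arrays"
  using array_of_in_arrays[OF assms] by (auto simp: solution_arrays_def)

section \<open>Exchanging row vectors\<close>

text \<open>The additive form avoids truncated subtraction. Equal row indices give Move 1, adjacent
  ones Moves 2--5.\<close>

definition exchange :: "(nat \<Rightarrow> nat) \<Rightarrow> nat \<Rightarrow> (nat \<Rightarrow> nat) \<Rightarrow> nat \<Rightarrow> arr \<Rightarrow> arr \<Rightarrow> bool" where
  "exchange u b\<^sub>u v b\<^sub>v A B \<longleftrightarrow>
     (\<forall>a b. B a b + (if b = b\<^sub>u then u a else 0) = A a b + (if b = b\<^sub>v then v a else 0))"

lemma mass_rows: "mass f N c = (\<Sum>b\<le>N. \<Sum>a\<le>2. f a b * of_nat (c a b))"
  unfolding mass_def by (subst sum.swap) (simp add: sum.cartesian_product)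

text \<open>A vector placed in a single row is itself an array and \<open>mass\<close> is additive,
  so the exchange equation can be summed as it stands.\<close>

lemma mass_exchange:
  assumes "exchange u b\<^sub>u v b\<^sub>v A B" "b\<^sub>u \<le> N" "b\<^sub>v \<le> N"
  shows "mass f N B + (\<Sum>a\<le>2. f a b\<^sub>u * of_nat (u a)) = mass f N A + (\<Sum>a\<le>2. f a b\<^sub>v * of_nat (v a))"
proof -
  have single: "(\<Sum>a\<le>2. f a b' * of_nat (w a)) = mass f N (\<lambda>a b. if b = b' then w a else 0)"
    if "b' \<le> N" for w :: "nat \<Rightarrow> nat" and b'
  proof -
    have "mass f N (\<lambda>a b. if b = b' then w a else 0) =
        (\<Sum>b\<le>N. if b = b' then \<Sum>a\<le>2. f a b * of_nat (w a) else 0)"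
      unfolding mass_rows by (intro sum.cong) auto
    then show ?thesis using that by simp
  qed
  have add: "mass f N c + mass f N d = mass f N (\<lambda>a b. c a b + d a b)" for c d
    by (simp add: mass_def sum.distrib[symmetric] distrib_left split_def)
  show ?thesis
    using assms by (simp add: single add exchange_def)
qed

lemma supported_exchange:
  assumes "exchange u b\<^sub>u v b\<^sub>v A B" "supported N A" "b\<^sub>v \<le> N" "\<And>a. a > 2 \<Longrightarrow> v a = 0"
  shows "supported N B"
  unfolding supported_def
proof (intro allI impI)
  fix a b assume B: "B a b \<noteq> 0"
  have "A a b \<noteq> 0 \<or> (b = b\<^sub>v \<and> v a \<noteq> 0)"
    using assms(1)[unfolded exchange_def, rule_format, of a b] B by (auto split: if_splits)
  then show "a \<le> 2 \<and> b \<le> N"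
    using assms(2-4) by (metis not_le supported_def)
qed

section \<open>Rules of Moves 2--5 by residue modulo 4\<close>

definition move_rule :: "nat \<Rightarrow> nat \<Rightarrow> rule option" where
  "move_rule k m =
     (if m = 2 then rule2 k else if m = 3 then rule3 k else if m = 4 then rule4 k
      else if m = 5 then rule5 k else None)"

text \<open>The number of terms lost by Move \<open>m\<close>; the value means nothing if there is no such move
  for this \<open>k\<close>.\<close>

definition size_drop :: "nat \<Rightarrow> nat \<Rightarrow> int" where
  "size_drop k m =
     (if m = 1 then 1
      else if m = 2 then
        (if k mod 4 = 0 then int k div 4 - 1 else if odd k then int k - 1 else int k div 2 - 1)
      else if m = 3 then (if k mod 4 = 1 then (int k - 1) div 4 else (3 * int k - 5) div 4)
      else if m = 4 then (if odd k then (int k - 1) div 2 else (int k - 2) div 4)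
      else (if k mod 4 = 1 then 3 * ((int k - 1) div 4) else (int k + 1) div 4))"

lemma atMost_2: "{..2::nat} = {0, 1, 2}"
  by auto

lemma mod_4_cases:
  fixes k :: nat
  obtains q where "k = 4 * q" | q where "k = 4 * q + 1" | q where "k = 4 * q + 2" | q where "k = 4 * q + 3"
proof -
  have "(\<exists>q. k = 4 * q) \<or> (\<exists>q. k = 4 * q + 1) \<or> (\<exists>q. k = 4 * q + 2) \<or> (\<exists>q. k = 4 * q + 3)" by presburger
  then show thesis using that by blast
qed

text \<open>Writing \<open>k\<close> as \<open>4 * q\<close> plus a residue removes all divisions
  from rules and size drops; later case analyses become linear in \<open>q\<close>.\<close>

lemma rules_mod_4_eq_0:
  assumes "k = 4 * q"
  shows "rule2 k = Some (row q 0 0, row 0 0 1)" "rule3 k = None" "rule4 k = None" "rule5 k = None"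
    and "size_drop k 2 = int q - 1"
  using assms by (simp_all add: rule2_def rule3_def rule4_def rule5_def size_drop_def)

lemma rules_mod_4_eq_1:
  assumes "k = 4 * q + 1"
  shows "rule2 k = Some (row k 0 0, row 1 0 0)" "rule3 k = Some (row q 0 1, row 0 0 1)"
    "rule4 k = Some (row (2 * q) 1 0, row 0 1 0)" "rule5 k = Some (row (3 * q) 1 1, row 0 1 1)"
    and "size_drop k 2 = 4 * int q" "size_drop k 3 = int q" "size_drop k 4 = 2 * int q"
    "size_drop k 5 = 3 * int q"
proof -
  have facts: "k mod 4 = 1" "odd k" "(k - 1) div 4 = q" "(k - 1) div 2 = 2 * q" "(3 * k - 3) div 4 = 3 * q"
    "int k - 1 = 4 * int q" "(int k - 1) div 4 = int q" "(int k - 1) div 2 = 2 * int q"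
    unfolding assms by simp_all
  show "rule2 k = Some (row k 0 0, row 1 0 0)" "rule3 k = Some (row q 0 1, row 0 0 1)"
    "rule4 k = Some (row (2 * q) 1 0, row 0 1 0)" "rule5 k = Some (row (3 * q) 1 1, row 0 1 1)"
    "size_drop k 2 = 4 * int q" "size_drop k 3 = int q" "size_drop k 4 = 2 * int q"
    "size_drop k 5 = 3 * int q"
    by (simp_all add: rule2_def rule3_def rule4_def rule5_def size_drop_def facts del: One_nat_def)
qed

lemma rules_mod_4_eq_2:
  assumes "k = 4 * q + 2"
  shows "rule2 k = Some (row (2 * q + 1) 0 0, row 0 1 0)" "rule3 k = None"
    "rule4 k = Some (row q 1 0, row 0 0 1)" "rule5 k = None"
    and "size_drop k 2 = 2 * int q" "size_drop k 4 = int q"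
proof -
  have facts: "k mod 4 = 2" "even k" "k div 2 = 2 * q + 1" "(k - 2) div 4 = q"
    "int k div 2 - 1 = 2 * int q" "(int k - 2) div 4 = int q"
    unfolding assms by simp_all presburger
  show "rule2 k = Some (row (2 * q + 1) 0 0, row 0 1 0)" "rule3 k = None"
    "rule4 k = Some (row q 1 0, row 0 0 1)" "rule5 k = None"
    "size_drop k 2 = 2 * int q" "size_drop k 4 = int q"
    by (simp_all add: rule2_def rule3_def rule4_def rule5_def size_drop_def facts del: One_nat_def)
qed

lemma rules_mod_4_eq_3:
  assumes "k = 4 * q + 3"
  shows "rule2 k = Some (row k 0 0, row 1 0 0)" "rule3 k = Some (row (3 * q + 2) 0 1, row 0 1 1)"
    "rule4 k = Some (row (2 * q + 1) 1 0, row 0 1 0)" "rule5 k = Some (row q 1 1, row 0 0 1)"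
    and "size_drop k 2 = 4 * int q + 2" "size_drop k 3 = 3 * int q + 1" "size_drop k 4 = 2 * int q + 1"
    "size_drop k 5 = int q + 1"
proof -
  have facts: "k mod 4 = 3" "odd k" "(3 * k - 1) div 4 = 3 * q + 2" "(k - 1) div 2 = 2 * q + 1"
    "(k - 3) div 4 = q" "int k - 1 = 4 * int q + 2" "(3 * int k - 5) div 4 = 3 * int q + 1"
    "(int k - 1) div 2 = 2 * int q + 1" "(int k + 1) div 4 = int q + 1"
    unfolding assms by simp_all
  show "rule2 k = Some (row k 0 0, row 1 0 0)" "rule3 k = Some (row (3 * q + 2) 0 1, row 0 1 1)"
    "rule4 k = Some (row (2 * q + 1) 1 0, row 0 1 0)" "rule5 k = Some (row q 1 1, row 0 0 1)"
    "size_drop k 2 = 4 * int q + 2" "size_drop k 3 = 3 * int q + 1" "size_drop k 4 = 2 * int q + 1"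
    "size_drop k 5 = int q + 1"
    by (simp_all add: rule2_def rule3_def rule4_def rule5_def size_drop_def facts del: One_nat_def)
qed

lemma row_simps [simp]:
  "row x y z 0 = x" "row x y z 1 = y" "row x y z (Suc 0) = y" "row x y z 2 = z"
  "a > 2 \<Longrightarrow> row x y z a = 0"
  by (auto simp: row_def)

text \<open>A row is worth \<open>4 * x + 2 * y + z\<close>, and a unit one row higher is worth
  \<open>k\<close> times less; the first equation thus says that the reciprocal sum is kept. The
  last claim protects the padding columns.\<close>

lemma move_rule_balanced:
  assumes "move_rule k m = Some (u, v)"
  shows "(\<Sum>a\<le>2. 2 ^ (2 - a) * u a) = k * (\<Sum>a\<le>2. 2 ^ (2 - a) * v a)"
    and "int (\<Sum>a\<le>2. u a) = int (\<Sum>a\<le>2. v a) + size_drop k m"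
    and "a > 2 \<Longrightarrow> v a = 0"
proof -
  have m: "(m = 2 \<and> rule2 k = Some (u, v)) \<or> (m = 3 \<and> rule3 k = Some (u, v)) \<or>
      (m = 4 \<and> rule4 k = Some (u, v)) \<or> (m = 5 \<and> rule5 k = Some (u, v))"
    using assms by (auto simp: move_rule_def split: if_splits)
  have "(\<Sum>a\<le>2. 2 ^ (2 - a) * u a) = k * (\<Sum>a\<le>2. 2 ^ (2 - a) * v a) \<and>
      int (\<Sum>a\<le>2. u a) = int (\<Sum>a\<le>2. v a) + size_drop k m \<and> (\<forall>a > 2. v a = 0)"
  proof (cases k rule: mod_4_cases)
    case (1 q)
    then show ?thesis using m by (auto simp: rules_mod_4_eq_0 atMost_2)
  next
    case (2 q)
    then show ?thesis using m rules_mod_4_eq_1[OF 2] by (elim disjE conjE) (auto simp: atMost_2)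
  next
    case (3 q)
    then show ?thesis using m rules_mod_4_eq_2[OF 3] by (elim disjE conjE) (auto simp: atMost_2)
  next
    case (4 q)
    then show ?thesis using m rules_mod_4_eq_3[OF 4] by (elim disjE conjE) (auto simp: atMost_2)
  qed
  then show "(\<Sum>a\<le>2. 2 ^ (2 - a) * u a) = k * (\<Sum>a\<le>2. 2 ^ (2 - a) * v a)"
    and "int (\<Sum>a\<le>2. u a) = int (\<Sum>a\<le>2. v a) + size_drop k m"
    and "a > 2 \<Longrightarrow> v a = 0" by blast+
qed

section \<open>Priority reductions and their invariants\<close>

lemma row_le_iff: "(\<forall>a. row x y z a \<le> f a) \<longleftrightarrow> x \<le> f 0 \<and> y \<le> f 1 \<and> z \<le> f 2"
  unfolding row_def by (auto simp: fun_upd_def numeral_2_eq_2)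

lemma apply_rule_eq_Some_iff:
  "apply_rule r \<beta> A = Some B \<longleftrightarrow>
     (\<exists>u v b. r = Some (u, v) \<and> \<beta> = Suc b \<and> (\<forall>a. u a \<le> A a (b + 1)) \<and>
       B = (\<lambda>a b'. if b' = b + 1 then A a b' - u a else if b' = b then A a b' + v a else A a b'))"
  by (auto simp: apply_rule_def split: option.splits nat.splits)

text \<open>For \<open>k \<equiv> 1 (mod 4)\<close> Move 5 never is a priority reduction, since Move 4 needs less.\<close>

lemma priority_reduction_cases:
  assumes "priority_reduction k m A B"
  obtains a where "m = 1" "a \<le> 1" "move1 a (top_row A) A = Some B"
  | u v where "move_rule k m = Some (u, v)"
      "m = 2 \<or> m = 3 \<or> m = 4 \<or> (m = 5 \<and> k mod 4 = 3)"
      "apply_rule (Some (u, v)) (top_row A) A = Some B"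
proof -
  let ?r = "\<lambda>r. apply_rule r (top_row A) A"
  \<comment> \<open>\<open>find\<close> reaches Move 5 only after Move 4 has failed; this failure is
    recorded because it excludes residue 1.\<close>
  consider a where "m = 1" "a \<le> 1" "move1 a (top_row A) A = Some B"
    | "m = 2" "?r (rule2 k) = Some B"
    | "m = 3" "?r (rule3 k) = Some B"
    | "m = 4" "?r (rule4 k) = Some B"
    | "m = 5" "?r (rule5 k) = Some B" "?r (rule4 k) = None"
    using assms unfolding priority_reduction_def candidates_def Let_def
    by (auto split: if_splits)
  then show ?thesis
  proof cases
    case 1
    then show ?thesis by (rule that(1))
  next
    case 2
    then show ?thesis by (auto simp: apply_rule_eq_Some_iff move_rule_def intro!: that(2))
  next
    case 3
    then show ?thesis by (auto simp: apply_rule_eq_Some_iff move_rule_def intro!: that(2))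
  next
    case 4
    then show ?thesis by (auto simp: apply_rule_eq_Some_iff move_rule_def intro!: that(2))
  next
    case 5
    have "k mod 4 = 3"
    proof (cases k rule: mod_4_cases)
      case (1 q)
      then show ?thesis using 5(2) by (simp add: rules_mod_4_eq_0 apply_rule_def)
    next
      case (2 q)
      then have "apply_rule (rule4 k) (top_row A) A \<noteq> None"
        using 5(2) by (auto simp: rules_mod_4_eq_1 apply_rule_def row_le_iff split: nat.splits if_splits)
      then show ?thesis using 5(3) by simp
    next
      case (3 q)
      then show ?thesis using 5(2) by (simp add: rules_mod_4_eq_2 apply_rule_def)
    next
      case (4 q)
      then show ?thesis by presburger
    qed
    then show ?thesis using 5 by (auto simp: apply_rule_eq_Some_iff move_rule_def intro!: that(2))
  qed
qed

text \<open>Brings all moves into one shape, so that the invariants need a single proof. The powers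
  \<open>k ^ (N - b)\<close> are the row factors of \<open>scaled_weight\<close>.\<close>

lemma priority_reduction_exchange:
  assumes "priority_reduction k m A B" "top_row A \<le> N"
  obtains u b\<^sub>u v b\<^sub>v where "exchange u b\<^sub>u v b\<^sub>v A B" "b\<^sub>u \<le> N" "b\<^sub>v \<le> N" "\<forall>a > 2. v a = 0"
    "k ^ (N - b\<^sub>u) * (\<Sum>a\<le>2. 2 ^ (2 - a) * u a) = k ^ (N - b\<^sub>v) * (\<Sum>a\<le>2. 2 ^ (2 - a) * v a)"
    "int (\<Sum>a\<le>2. u a) = int (\<Sum>a\<le>2. v a) + size_drop k m"
  using assms(1)
proof (cases rule: priority_reduction_cases)
  case (1 a)
  \<comment> \<open>Two units of column \<open>a + 1\<close> for one of column \<open>a\<close> in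
    the same row; their weights agree because \<open>a \<le> 1\<close>.\<close>
  let ?u = "\<lambda>a'. if a' = a + 1 then 2 else 0" and ?v = "\<lambda>a'. if a' = a then 1 else 0"
  have a: "a = 0 \<or> a = 1" using 1 by auto
  show ?thesis
  proof (rule that)
    show "exchange ?u (top_row A) ?v (top_row A) A B"
      using 1(3) by (auto simp: move1_def exchange_def split: if_splits)
  qed (use 1 a assms(2) in \<open>auto simp: atMost_2 size_drop_def\<close>)
next
  case (2 u v)
  obtain b where b: "top_row A = Suc b" "\<forall>a. u a \<le> A a (b + 1)"
      "B = (\<lambda>a b'. if b' = b + 1 then A a b' - u a else if b' = b then A a b' + v a else A a b')"
    using 2(3) by (auto simp: apply_rule_eq_Some_iff)
  note balanced = move_rule_balanced[OF 2(1)]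
  show ?thesis
  proof (rule that)
    show "exchange u (Suc b) v b A B"
      using b(2) by (auto simp: exchange_def b(3))
    \<comment> \<open>The lower row has one more factor \<open>k\<close>, which absorbs the
      \<open>k\<close> in the balance equation.\<close>
    have "N - b = Suc (N - Suc b)" using assms(2) b(1) by simp
    then show "k ^ (N - Suc b) * (\<Sum>a\<le>2. 2 ^ (2 - a) * u a) = k ^ (N - b) * (\<Sum>a\<le>2. 2 ^ (2 - a) * v a)"
      unfolding balanced(1) by simp
  qed (use b balanced assms(2) in auto)
qed

lemma priority_reduction_invariants:
  assumes "priority_reduction k m A B" "supported N A" "top_row A \<le> N"
  shows "supported N B" "scaled_weight k N B = scaled_weight k N A"
    and "int (array_size N A) = int (array_size N B) + size_drop k m"
proof -
  obtain u b\<^sub>u v b\<^sub>v where ex: "exchange u b\<^sub>u v b\<^sub>v A B" and le: "b\<^sub>u \<le> N" "b\<^sub>v \<le> N"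
    and v: "\<forall>a > 2. v a = 0"
    and weight: "k ^ (N - b\<^sub>u) * (\<Sum>a\<le>2. 2 ^ (2 - a) * u a) = k ^ (N - b\<^sub>v) * (\<Sum>a\<le>2. 2 ^ (2 - a) * v a)"
    and size: "int (\<Sum>a\<le>2. u a) = int (\<Sum>a\<le>2. v a) + size_drop k m"
    using priority_reduction_exchange[OF assms(1,3)] by blast
  show "supported N B" by (rule supported_exchange[OF ex assms(2) le(2)]) (use v in blast)
  have "(\<Sum>a\<le>2. 2 ^ (2 - a) * k ^ (N - b) * of_nat (w a)) = k ^ (N - b) * (\<Sum>a\<le>2. 2 ^ (2 - a) * w a)"
    for b w unfolding sum_distrib_left by (intro sum.cong) simp_all
  then show "scaled_weight k N B = scaled_weight k N A"
    using mass_exchange[OF ex le, of "\<lambda>a b. 2 ^ (2 - a) * k ^ (N - b)"] weight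
    by (simp only: scaled_weight_def add_right_cancel)
  have "array_size N B + (\<Sum>a\<le>2. u a) = array_size N A + (\<Sum>a\<le>2. v a)"
    using mass_exchange[OF ex le, of "\<lambda>_ _. 1::nat"] by (simp add: array_size_def)
  then show "int (array_size N A) = int (array_size N B) + size_drop k m"
    using size by linarith
qed

section \<open>Existence of a priority reduction\<close>

lemma top_row_supported:
  assumes "supported N A" "A a b \<noteq> 0"
  shows "supported (top_row A) A" and "\<exists>a. A a (top_row A) \<noteq> 0"
proof -
  let ?R = "{b. \<exists>a. A a b \<noteq> 0}"
  have fin: "finite ?R"
    by (rule finite_subset[of _ "{..N}"]) (use assms(1) in \<open>auto simp: supported_def\<close>)
  have "b \<le> top_row A" if "A a b \<noteq> 0" for a b
    unfolding top_row_def using fin that by (intro Max_ge) auto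
  then show "supported (top_row A) A" using assms(1) by (simp add: supported_def)
  have "top_row A \<in> ?R" unfolding top_row_def using fin assms(2) by (intro Max_in) auto
  then show "\<exists>a. A a (top_row A) \<noteq> 0" by simp
qed

lemma base_4_unique:
  fixes x w :: nat
  assumes "4 * x + r = 4 * w + s" "r < 4" "s < 4"
  shows "x = w \<and> r = s"
proof -
  have "x = w" using assms by linarith
  then show ?thesis using assms(1) by simp
qed

text \<open>The multiples \<open>k\<close>, \<open>2 * k\<close>, \<open>3 * k\<close> are matched
  with their base-4 digits, and from \<open>4 * k\<close> on Move 2 has enough in column 0. The
  conclusion speaks of any \<open>f\<close> with the given first three values so that it fits the
  top row of an array.\<close>

lemma rule_applicable:
  assumes "k dvd 4 * x + 2 * y + z" "4 * x + 2 * y + z > 0" "y \<le> 1" "z \<le> 1"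
  obtains r u v where "r \<in> {rule2 k, rule3 k, rule4 k, rule5 k}" "r = Some (u, v)"
    "\<And>f. f 0 = x \<Longrightarrow> f 1 = y \<Longrightarrow> f 2 = z \<Longrightarrow> \<forall>a. u a \<le> f a"
proof -
  obtain p where p: "4 * x + 2 * y + z = k * p" using assms(1) by blast
  have "p > 0" using p assms(2) by (cases p) auto
  moreover have "k * 4 \<le> k * p" if "p \<ge> 4" using that by simp
  ultimately have "4 * x + 2 * y + z = k \<or> 4 * x + 2 * y + z = 2 * k \<or> 4 * x + 2 * y + z = 3 * k \<or>
      4 * x + 2 * y + z \<ge> 4 * k"
    using p by (cases "p \<ge> 4") (auto simp: not_le less_Suc_eq numeral_eq_Suc)
  note multiple = this and found = that
  have applicable: thesis
    if "r = Some (row a b c, w)" "r \<in> {rule2 k, rule3 k, rule4 k, rule5 k}" "a \<le> x" "b \<le> y" "c \<le> z"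
    for r a b c w
    using that by (intro found[of r "row a b c" w]) (simp_all add: row_le_iff)
  \<comment> \<open>\<open>2 * y + z \<le> 3\<close>, so it is the remainder modulo 4 and
    \<open>x\<close> is the quotient.\<close>
  have digits: "x = w \<and> 2 * y + z = s" if "4 * x + 2 * y + z = 4 * w + s" "s < 4" for w s
    using base_4_unique[of x "2 * y + z" w s] that assms(3,4) by simp
  have large: "k \<le> x" if "4 * x + 2 * y + z \<ge> 4 * k"
    using that assms(3,4) by linarith
  have y: "y = 1" if "2 * y + z = 2 \<or> 2 * y + z = 3" using that assms(3,4) by linarith
  have z: "z = 1" if "2 * y + z = 1 \<or> 2 * y + z = 3" using that assms(4) by presburger
  show thesis
  proof (cases k rule: mod_4_cases)
    case (1 q)
    \<comment> \<open>Every positive multiple is at least \<open>4 * q\<close>, and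
      \<open>y\<close>, \<open>z\<close> contribute at most 3.\<close>
    have "q \<le> x" using multiple assms(3,4) unfolding 1 by linarith
    then show ?thesis using applicable[OF rules_mod_4_eq_0(1)[OF 1]] by simp
  next
    case (2 q)
    note rules = rules_mod_4_eq_1[OF 2]
    \<comment> \<open>The multiples \<open>k\<close>, \<open>2 * k\<close>, \<open>3 * k\<close>
      have remainders 1, 2, 3 and quotients \<open>q\<close>, \<open>2 * q\<close>,
      \<open>3 * q\<close>; Move 4 serves both of the last two.\<close>
    have "k \<le> x \<or> (q \<le> x \<and> z = 1) \<or> (2 * q \<le> x \<and> y = 1)"
      using multiple
    proof (elim disjE)
      assume "4 * x + 2 * y + z = k"
      then show ?thesis using digits[of "q" 1] z by (simp add: 2)
    next
      assume "4 * x + 2 * y + z = 2 * k"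
      then show ?thesis using digits[of "2 * q" 2] y by (simp add: 2)
    next
      assume "4 * x + 2 * y + z = 3 * k"
      then show ?thesis using digits[of "3 * q" 3] y by (simp add: 2)
    next
      assume "4 * x + 2 * y + z \<ge> 4 * k"
      then show ?thesis using large by simp
    qed
    then show ?thesis
      using applicable[OF rules(1)] applicable[OF rules(2)] applicable[OF rules(3)] by auto
  next
    case (3 q)
    note rules = rules_mod_4_eq_2[OF 3]
    \<comment> \<open>Here the remainders are 2, 0, 2 with quotients \<open>q\<close>,
      \<open>2 * q + 1\<close>, \<open>3 * q + 1\<close>.\<close>
    have "2 * q + 1 \<le> x \<or> (q \<le> x \<and> y = 1)"
      using multiple
    proof (elim disjE)
      assume "4 * x + 2 * y + z = k"
      then show ?thesis using digits[of "q" 2] y by (simp add: 3)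
    next
      assume "4 * x + 2 * y + z = 2 * k"
      then show ?thesis using digits[of "2 * q + 1" 0] y by (simp add: 3)
    next
      assume "4 * x + 2 * y + z = 3 * k"
      then show ?thesis using digits[of "3 * q + 1" 2] y by (simp add: 3)
    next
      assume "4 * x + 2 * y + z \<ge> 4 * k"
      then show ?thesis using large 3 by simp
    qed
    then show ?thesis using applicable[OF rules(1)] applicable[OF rules(3)] by auto
  next
    case (4 q)
    note rules = rules_mod_4_eq_3[OF 4]
    \<comment> \<open>Here the remainders are 3, 2, 1 with quotients \<open>q\<close>,
      \<open>2 * q + 1\<close>, \<open>3 * q + 2\<close>, calling for Moves 5, 4, 3.\<close>
    have "k \<le> x \<or> (3 * q + 2 \<le> x \<and> z = 1) \<or> (2 * q + 1 \<le> x \<and> y = 1) \<or> (q \<le> x \<and> y = 1 \<and> z = 1)"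
      using multiple
    proof (elim disjE)
      assume "4 * x + 2 * y + z = k"
      then show ?thesis using digits[of "q" 3] y z by (simp add: 4)
    next
      assume "4 * x + 2 * y + z = 2 * k"
      then show ?thesis using digits[of "2 * q + 1" 2] y by (simp add: 4)
    next
      assume "4 * x + 2 * y + z = 3 * k"
      then show ?thesis using digits[of "3 * q + 2" 1] z by (simp add: 4)
    next
      assume "4 * x + 2 * y + z \<ge> 4 * k"
      then show ?thesis using large by simp
    qed
    then show ?thesis
      using applicable[OF rules(1)] applicable[OF rules(2)] applicable[OF rules(3)]
        applicable[OF rules(4)] by auto
  qed
qed

text \<open>Rows below the top carry a positive power of \<open>k\<close> in the scaled sum, and so
  does the total; hence \<open>k\<close> divides what the top row contributes.\<close>

lemma top_row_divisible:
  assumes "scaled_weight k (Suc b) A = 4 * k ^ Suc b"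
  shows "k dvd 4 * A 0 (Suc b) + 2 * A 1 (Suc b) + A 2 (Suc b)"
proof -
  let ?lower = "\<Sum>b'\<le>b. \<Sum>a\<le>2. 2 ^ (2 - a) * k ^ (Suc b - b') * A a b'"
  have "k dvd ?lower" by (intro dvd_sum) (auto simp: Suc_diff_le)
  moreover have "?lower + (4 * A 0 (Suc b) + 2 * A 1 (Suc b) + A 2 (Suc b)) = 4 * k ^ Suc b"
    using assms by (simp add: scaled_weight_def mass_rows atMost_2)
  then have "k dvd ?lower + (4 * A 0 (Suc b) + 2 * A 1 (Suc b) + A 2 (Suc b))" by simp
  ultimately show ?thesis by (simp only: dvd_add_right_iff)
qed

lemma priority_reduction_exists:
  assumes N: "supported N A" "scaled_weight k N A = 4 * k ^ N"
    and N_top: "N = top_row A" and size: "array_size N A \<ge> 2"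
  obtains m B where "priority_reduction k m A B"
proof (rule ccontr)
  assume "\<not> thesis"
  then have none: "\<not> priority_reduction k m A B" for m B using that by blast
  have "find (\<lambda>(_, r). r \<noteq> None) (candidates k A) = None"
  proof (cases "find (\<lambda>(_, r). r \<noteq> None) (candidates k A)")
    case (Some p)
    moreover obtain m r where p: "p = (m, r)" by (cases p)
    moreover have "r \<noteq> None" using Some unfolding p find_Some_iff by auto
    ultimately show ?thesis using none unfolding priority_reduction_def by auto
  qed
  then have "\<forall>(m, r) \<in> set (candidates k A). r = None"
    by (auto simp: find_None_iff)
  then have "move1 1 N A = None" "move1 0 N A = None"
    and rules: "\<And>r. r \<in> {rule2 k, rule3 k, rule4 k, rule5 k} \<Longrightarrow> apply_rule r N A = None"
    by (auto simp: candidates_def Let_def N_top)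
  then have le: "A 1 N \<le> 1" "A 2 N \<le> 1"
    by (auto simp: move1_def numeral_2_eq_2 split: if_splits)
  obtain a b where "A a b \<noteq> 0"
    using size by (force simp: array_size_def mass_def)
  note top = top_row_supported(2)[OF N(1) this, folded N_top]
  show False
  proof (cases N)
    \<comment> \<open>With entries at most 1 in columns 1 and 2, weight 4 leaves only the row
      \<open>(1, 0, 0)\<close>, which has a single term.\<close>
    case 0
    then have "4 * A 0 0 + 2 * A 1 0 + A 2 0 = 4" "2 \<le> A 0 0 + A 1 0 + A 2 0"
      using N(2) size by (simp_all add: scaled_weight_def array_size_def mass_rows atMost_2)
    then show False using le unfolding 0 by (cases "A 0 0") auto
  next
    case (Suc b)
    obtain a where "A a N \<noteq> 0" "a \<le> 2" using top N(1) unfolding supported_def by blast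
    then have pos: "4 * A 0 N + 2 * A 1 N + A 2 N > 0"
      by (cases "a = 0"; cases "a = 1"; cases "a = 2") auto
    show False
    proof (rule rule_applicable[OF top_row_divisible[OF N(2)[unfolded Suc], folded Suc] pos le])
      fix r u v
      assume r: "r \<in> {rule2 k, rule3 k, rule4 k, rule5 k}" "r = Some (u, v)"
        and u: "\<And>f. f 0 = A 0 N \<Longrightarrow> f 1 = A 1 N \<Longrightarrow> f 2 = A 2 N \<Longrightarrow> \<forall>a. u a \<le> f a"
      have "\<forall>a. u a \<le> A a N" by (rule u) (rule refl)+
      then show False using rules[OF r(1)] r(2) by (simp add: apply_rule_def Suc)
    qed
  qed
qed

section \<open>Descent and a uniform recursion\<close>

text \<open>Makes the induction on the number of terms descend. The value 4 must be excluded: there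
  Move 2 would have drop 0.\<close>

lemma size_drop_pos:
  assumes "k \<ge> 3" "k \<noteq> 4"
  shows "size_drop k m > 0"
proof -
  have bounds: "k mod 4 = 0 \<Longrightarrow> k \<ge> 8" "k mod 4 = 1 \<Longrightarrow> k \<ge> 5" "even k \<Longrightarrow> k \<ge> 6"
    using assms by presburger+
  have "k mod 4 = 0 \<Longrightarrow> int k div 4 - 1 > 0" "k mod 4 = 1 \<Longrightarrow> (int k - 1) div 4 > 0"
    "even k \<Longrightarrow> (int k - 2) div 4 > 0" "even k \<Longrightarrow> int k div 2 - 1 > 0"
    "(int k - 1) div 2 > 0" "int k - 1 > 0" "(3 * int k - 5) div 4 > 0" "(int k + 1) div 4 > 0"
    by (use bounds assms(1) in linarith)+
  then show ?thesis unfolding size_drop_def by (simp only: split: if_split) simp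
qed

text \<open>The moves named in the recursion for \<open>Sol\<close>; Move 5 is absent for residue 1,
  in line with \<open>priority_reduction_cases\<close>.\<close>

definition possible_moves :: "nat \<Rightarrow> nat set" where
  "possible_moves k =
     (if k mod 4 = 0 then {1, 2} else if k mod 4 = 1 then {1, 2, 3, 4}
      else if k mod 4 = 2 then {1, 2, 4} else {1, 2, 3, 4, 5})"

lemma priority_reduction_possible_moves:
  assumes "priority_reduction k m A B"
  shows "m \<in> possible_moves k"
  using assms
proof (cases rule: priority_reduction_cases)
  case (1 a)
  then show ?thesis by (simp add: possible_moves_def)
next
  case (2 u v)
  have "m \<noteq> 3 \<and> m \<noteq> 4" if "k mod 4 = 0"
  proof -
    have "even k" using that by presburger
    then show ?thesis using 2(1) that by (auto simp: move_rule_def rule3_def rule4_def)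
  qed
  moreover have "m \<noteq> 3" if "k mod 4 = 2"
    using 2(1) that by (auto simp: move_rule_def rule3_def)
  ultimately show ?thesis using 2(2) unfolding possible_moves_def by (auto split: if_split)
qed

lemma Sol_eq_Union:
  assumes "k > 0" "\<not> (\<exists>i. k = 2 ^ i)" "j \<ge> 2"
  shows "Sol k j = (\<Union>m\<in>possible_moves k. prio_expansions k m (Sol k (j - size_drop k m)))"
proof -
  have j: "\<not> (k = 0 \<or> (\<exists>i. k = 2 ^ i))" "\<not> j \<le> 0" "j \<noteq> 1" using assms by auto
  have "k mod 4 = 0 \<or> k mod 4 = 1 \<and> odd k \<or> k mod 4 = 2 \<and> even k \<or> k mod 4 = 3 \<and> odd k" by presburger
  then show ?thesis
  proof (elim disjE conjE)
    assume k: "k mod 4 = 0"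
    show ?thesis
      by (subst Sol.simps) (simp add: j k possible_moves_def size_drop_def del: One_nat_def)
  next
    assume k: "k mod 4 = 1" "odd k"
    show ?thesis
      by (subst Sol.simps) (simp add: j k possible_moves_def size_drop_def Un_assoc del: One_nat_def)
  next
    assume k: "k mod 4 = 2" "even k"
    show ?thesis
      by (subst Sol.simps) (simp add: j k possible_moves_def size_drop_def Un_assoc del: One_nat_def)
  next
    assume k: "k mod 4 = 3" "odd k"
    show ?thesis
      by (subst Sol.simps) (simp add: j k possible_moves_def size_drop_def Un_assoc del: One_nat_def)
  qed
qed

text \<open>A priority reduction always belongs to \<open>possible_moves k\<close>, so the union may
  be taken over all \<open>m\<close> and the case split on \<open>k\<close> disappears.\<close>

lemma Sol_iff:
  assumes "k > 0" "\<not> (\<exists>i. k = 2 ^ i)" "j \<ge> 2"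
  shows "A \<in> Sol k j \<longleftrightarrow>
    A \<in> arrays \<and> (\<exists>m B. priority_reduction k m A B \<and> B \<in> Sol k (j - size_drop k m))"
  unfolding Sol_eq_Union[OF assms] prio_expansions_def
  using priority_reduction_possible_moves by blast

section \<open>Base case and induction on the number of terms\<close>

lemma solution_arrays_1:
  assumes "k > 1"
  shows "solution_arrays k 1 = {start_array}"
proof -
  have "array_of k [1] = start_array"
    using assms by (auto simp: fun_eq_iff array_of_eq_count start_array_def)
  moreover have "1 \<in> S_set k"
    unfolding S_set_def by (intro CollectI exI[of _ 0]) simp
  then have "solutions k 1 = {[1]}"
    by (auto simp: solutions_def length_Suc_conv)
  ultimately show ?thesis by (simp add: solution_arrays_def)
qed

theorem mainTheorem2:
  fixes k n :: nat
  assumes "k > 0" and "\<not> (\<exists>i. k = 2 ^ i)" and "n > 0"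
  shows "Sol k (int n) = solution_arrays k n"
  using assms(3)
proof (induction n rule: less_induct)
  case (less n)
  note k = assms(2,1)
  have "k \<noteq> 2 ^ 0" "k \<noteq> 2 ^ 1" "k \<noteq> 2 ^ 2" using assms(2) by metis+
  then have k3: "k \<ge> 3" "k \<noteq> 4" using assms(1) by auto
  show ?case
  proof (cases "n = 1")
    case True
    then show ?thesis using k k3 solution_arrays_1[of k] by (subst Sol.simps) simp
  next
    case False
    then have n: "n \<ge> 2" using less.prems by simp
    have IH: "Sol k (int n - size_drop k m) = solution_arrays k n'"
      if "int n' = int n - size_drop k m" "n' > 0" for m n'
      using less.IH[of n'] size_drop_pos[OF k3, of m] that by simp
    show ?thesis
    proof (intro set_eqI iffI)
      fix A assume "A \<in> Sol k (int n)"
      then obtain m B where "A \<in> arrays" and red: "priority_reduction k m A B"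
        and B: "B \<in> Sol k (int n - size_drop k m)"
        using Sol_iff[OF assms(1,2), of "int n"] n by auto
      \<comment> \<open>\<open>Sol\<close> is empty at nonpositive indices, so membership of
        \<open>B\<close> puts the index in the range of the induction hypothesis.\<close>
      have "int n - size_drop k m > 0" using B by (subst (asm) Sol.simps) (auto split: if_splits)
      then obtain n' where n': "int n' = int n - size_drop k m" "n' > 0"
        by (metis of_nat_0_less_iff zero_less_imp_eq_int)
      \<comment> \<open>\<open>A\<close> is not yet known to be nonzero, so \<open>top_row A\<close>
        could be a maximum of the empty set; the bound is enlarged to cover it.\<close>
      obtain N where N: "supported N A" "top_row A \<le> N"
        using \<open>A \<in> arrays\<close> supported_mono unfolding arrays_iff_supported by (meson nat_le_linear order_refl)
      note inv = priority_reduction_invariants[OF red N]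
      have "B \<in> solution_arrays k n'" using B IH[OF n'] by simp
      then show "A \<in> solution_arrays k n"
        using inv n' by (simp add: solution_arrays_iff[OF k N(1)] solution_arrays_iff[OF k inv(1)])
    next
      fix A assume A: "A \<in> solution_arrays k n"
      then have "A \<in> arrays" using solution_arrays_subset_arrays[OF k] by blast
      then obtain N where N: "supported N A" unfolding arrays_iff_supported ..
      have "array_size N A = n" using A solution_arrays_iff[OF k N] by simp
      then obtain a b where "A a b \<noteq> 0"
        using less.prems by (force simp: array_size_def mass_def)
      \<comment> \<open>The bound is now the top row itself, as
        \<open>priority_reduction_exists\<close> requires.\<close>
      note top = top_row_supported(1)[OF N this]
      obtain m B where red: "priority_reduction k m A B"
        using priority_reduction_exists[OF top _ refl] A n solution_arrays_iff[OF k top] by metis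
      note inv = priority_reduction_invariants[OF red top order_refl]
      define n' where "n' = array_size (top_row A) B"
      have B: "B \<in> solution_arrays k n'" and n': "int n' = int n - size_drop k m"
        using inv A by (simp_all add: solution_arrays_iff[OF k top] solution_arrays_iff[OF k inv(1)] n'_def)
      \<comment> \<open>The empty list has reciprocal sum 0, not 1.\<close>
      have "n' > 0" using B by (cases n') (auto simp: solution_arrays_def solutions_def)
      then have "B \<in> Sol k (int n - size_drop k m)" using B IH[OF n'] by simp
      then show "A \<in> Sol k (int n)"
        using Sol_iff[OF assms(1,2), of "int n"] n \<open>A \<in> arrays\<close> red by auto
    qed
  qed
qed

end
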